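(* Let $G=(V,E)$ be a finite directed acyclic graph, let $T$ be a $d$-separation tree for $G$, and let $u,v\in V$ be two distinct vertices. Then $u$ and $v$ are $d$-separated in $G$ (that is, there exists a set $S\subseteq V\setminus\{u,v\}$ such that $S$ $d$-separates $u$ and $v$ in $G$) if and only if at least one of the following holds: (i) $u$ and $v$ are not contained together in any node $C$ of $T$; or (ii) there exists a node $C$ of $T$ with $u,v\in C$ and a subset $S$ of $C$ (with $u,v\notin S$) such that $S$ $d$-separates $u$ and $v$ in $G$.
   Context: $d$-separation: Let $G=(V,E)$ be a finite directed acyclic graph (DAG). A path between two distinct vertices is a sequence of distinct vertices in which consecutive vertices are joined by an edge of $G$ (in either direction). An interior vertex $w$ of a path is a collider on the path if both path edges at $w$ point into $w$ ($\to w\leftarrow$), and a non-collider otherwise. A path is $d$-separated (blocked) by a set $Z\subseteq V$ if it contains a non-collider interior vertex that lies in $Z$, or a collider $w$ such that neither $w$ nor any descendant of $w$ lies in $Z$. For pairwise disjoint sets $X,Y,Z\subseteq V$, we say that $X$ and $Y$ are $d$-separated by $Z$ in $G$, written $\langle X,Y\mid Z\rangle_G$, if every path in $G$ from a vertex of $X$ to a vertex of $Y$ is $d$-separated by $Z$. For distinct vertices $u,v$, "$S$ $d$-separates $u$ and $v$" means $\langle\{u\},\{v\}\mid S\rangle_G$ (so $u,v\notin S$). Trees of variable sets: Let $\mathcal{C}=\{C_1,\dots,C_H\}$ be a collection of distinct subsets of $V$, and let $T$ be a (finite, connected, acyclic, undirected) tree whose nodes are the sets in $\mathcal{C}$. Each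 edge of $T$ joining nodes $C_i$ and $C_j$ is labeled by the separator $S=C_i\cap C_j$. Removing this edge splits $T$ into two subtrees $T_1$ and $T_2$; let $V_1$ and $V_2$ be the corresponding variable sets, where $V_k$ is the union of all the nodes of $T_k$. $d$-separation tree: $T$ is a $d$-separation tree for $G$ if (1) $\bigcup_{C_i\in\mathcal{C}}C_i=V$, and (2) for every edge of $T$, with separator $S$ (the intersection of the two nodes joined by the edge) and with $V_1$ and $V_2$ the unions of all the nodes of the two subtrees $T_1$ and $T_2$ obtained by removing that edge from $T$, $\langle V_1\setminus S,\,V_2\setminus S\mid S\rangle_G$ holds, i.e. $V_1\setminus S$ and $V_2\setminus S$ are $d$-separated by $S$ in $G$ (in particular, $V_1\setminus S$ and $V_2\setminus S$ are disjoint). *)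

theory Defs
  imports Main
begin

text \<open>Directed graphs are given by a vertex set \<open>V\<close> and an edge relation \<open>E\<close>;
  \<open>(x, y) \<in> E\<close> stands for the edge from \<open>x\<close> to \<open>y\<close>.\<close>

locale dag =
  fixes V :: "'a set" and E :: "('a \<times> 'a) set"
  assumes finite_verts: "finite V"
    and edges_subset: "E \<subseteq> V \<times> V"
    and acyclic_edges: "acyclic E"

definition is_path :: "('a \<times> 'a) set \<Rightarrow> 'a \<Rightarrow> 'a list \<Rightarrow> 'a \<Rightarrow> bool" where
  "is_path E u p v \<longleftrightarrow> u \<noteq> v \<and> p \<noteq> [] \<and> hd p = u \<and> last p = v \<and> distinct p \<and>
     successively (\<lambda>x y. (x, y) \<in> E \<or> (y, x) \<in> E) p"

definition descendants :: "('a \<times> 'a) set \<Rightarrow> 'a \<Rightarrow> 'a set" where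
  "descendants E w = {d. (w, d) \<in> E\<^sup>+}"

text \<open>Interior vertices of a path are referred to by their position in the list, the endpoints
  being at positions \<open>0\<close> and \<open>length p - 1\<close>.\<close>

definition interior :: "'a list \<Rightarrow> nat \<Rightarrow> bool" where
  "interior p i \<longleftrightarrow> 0 < i \<and> i + 1 < length p"

definition collider :: "('a \<times> 'a) set \<Rightarrow> 'a list \<Rightarrow> nat \<Rightarrow> bool" where
  "collider E p i \<longleftrightarrow> interior p i \<and> (p ! (i - 1), p ! i) \<in> E \<and> (p ! (i + 1), p ! i) \<in> E"

definition blocked :: "('a \<times> 'a) set \<Rightarrow> 'a set \<Rightarrow> 'a list \<Rightarrow> bool" where
  "blocked E Z p \<longleftrightarrow> (\<exists>i. interior p i \<and>
     (\<not> collider E p i \<and> p ! i \<in> Z \<or>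
      collider E p i \<and> p ! i \<notin> Z \<and> descendants E (p ! i) \<inter> Z = {}))"

definition d_separated ::
  "'a set \<Rightarrow> ('a \<times> 'a) set \<Rightarrow> 'a set \<Rightarrow> 'a set \<Rightarrow> 'a set \<Rightarrow> bool" where
  "d_separated V E X Y Z \<longleftrightarrow>
     X \<subseteq> V \<and> Y \<subseteq> V \<and> Z \<subseteq> V \<and> X \<inter> Y = {} \<and> X \<inter> Z = {} \<and> Y \<inter> Z = {} \<and>
     (\<forall>x\<in>X. \<forall>y\<in>Y. \<forall>p. is_path E x p y \<longrightarrow> blocked E Z p)"

text \<open>An undirected simple graph is given by a node set \<open>N\<close> and an irreflexive symmetric
  relation \<open>F\<close>, so that the edge joining \<open>a\<close> and \<open>b\<close> is represented by both \<open>(a, b)\<close>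
  and \<open>(b, a)\<close>. The constant \<open>acyclic\<close> refers to directed cycles and thus does not
  apply to \<open>F\<close>.\<close>

definition is_cycle :: "('n \<times> 'n) set \<Rightarrow> 'n list \<Rightarrow> bool" where
  "is_cycle F c \<longleftrightarrow> 3 \<le> length c \<and> distinct c \<and>
     successively (\<lambda>a b. (a, b) \<in> F) c \<and> (last c, hd c) \<in> F"

definition is_tree :: "'n set \<Rightarrow> ('n \<times> 'n) set \<Rightarrow> bool" where
  "is_tree N F \<longleftrightarrow> finite N \<and> N \<noteq> {} \<and> F \<subseteq> N \<times> N \<and> sym F \<and> irrefl F \<and>
     (\<forall>a\<in>N. \<forall>b\<in>N. (a, b) \<in> F\<^sup>*) \<and> (\<nexists>c. is_cycle F c)"

text \<open>The nodes of the subtree containing \<open>A\<close> after removal of the edge joining \<open>A\<close> and \<open>B\<close>.\<close>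

definition subtree_nodes :: "('n \<times> 'n) set \<Rightarrow> 'n \<Rightarrow> 'n \<Rightarrow> 'n set" where
  "subtree_nodes F A B = {D. (A, D) \<in> (F - {(A, B), (B, A)})\<^sup>*}"

definition d_separation_tree ::
  "'a set \<Rightarrow> ('a \<times> 'a) set \<Rightarrow> 'a set set \<Rightarrow> ('a set \<times> 'a set) set \<Rightarrow> bool" where
  "d_separation_tree V E \<C> F \<longleftrightarrow>
     is_tree \<C> F \<and> (\<forall>C\<in>\<C>. C \<subseteq> V) \<and> \<Union>\<C> = V \<and>
     (\<forall>A B. (A, B) \<in> F \<longrightarrow>
        (let S = A \<inter> B; V\<^sub>1 = \<Union>(subtree_nodes F A B); V\<^sub>2 = \<Union>(subtree_nodes F B A)
         in d_separated V E (V\<^sub>1 - S) (V\<^sub>2 - S) S))"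

end

theory Submission
  imports Defs
begin

text \<open>
  Each edge of the tree, with separator \<open>K\<close>, splits \<open>V\<close> into \<open>K\<close> and two sides between which
  there is neither an edge nor a common child lying in \<open>K\<close>. If \<open>u\<close> and \<open>v\<close> share no node,
  the first edge of a shortest tree path from a node containing \<open>u\<close> to a node containing
  \<open>v\<close> has a separator that \<open>d\<close>-separates them.

  Suppose \<open>u\<close> and \<open>v\<close> are non-adjacent and share a node; by symmetry \<open>u\<close> is not an ancestor of
  \<open>v\<close>. If \<open>S\<close> consists of ancestors of \<open>u\<close> and \<open>v\<close>, an unblocked path stays among these
  ancestors and therefore leaves \<open>u\<close> towards a parent of \<open>u\<close>. Among the nodes containing \<open>u\<close>
  and \<open>v\<close>, choose \<open>C\<close> with as many parents of \<open>u\<close> as possible and, if a parent \<open>p\<close> is missing,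
  as close as possible to a node containing \<open>p\<close>. If none is missing, the parents of \<open>u\<close> separate.
  Otherwise the tree edge from \<open>C\<close> towards \<open>p\<close> has all parents of \<open>u\<close> on its far
  side, because two parents of \<open>u\<close> cannot be strictly on opposite sides, while the choice of \<open>C\<close>
  puts \<open>v\<close> strictly on the near side. The ancestors of \<open>u\<close> and \<open>v\<close> other than \<open>u\<close> in its
  separator then separate \<open>u\<close> from \<open>v\<close>.
\<close>

section \<open>Paths and blocking\<close>

lemma interior_rev:
  "interior p i \<Longrightarrow> interior (rev p) (length p - 1 - i)"
  by (auto simp: interior_def)

lemma nth_rev_interior:
  assumes "interior p i"
  shows "rev p ! (length p - 1 - i) = p ! i"
    and "rev p ! (length p - 1 - i - 1) = p ! (i + 1)"
    and "rev p ! (length p - 1 - i + 1) = p ! (i - 1)"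
  using assms by (auto simp: interior_def rev_nth intro!: arg_cong[where f = "(!) p"])

lemma collider_rev:
  assumes "interior p i"
  shows "collider E (rev p) (length p - 1 - i) \<longleftrightarrow> collider E p i"
  using assms interior_rev[OF assms] nth_rev_interior[OF assms]
  unfolding collider_def by auto

lemma blocked_rev:
  assumes "blocked E Z p"
  shows "blocked E Z (rev p)"
proof -
  from assms obtain i where "interior p i"
    "\<not> collider E p i \<and> p ! i \<in> Z \<or>
      collider E p i \<and> p ! i \<notin> Z \<and> descendants E (p ! i) \<inter> Z = {}"
    unfolding blocked_def by blast
  then show ?thesis
    unfolding blocked_def
    by (intro exI[of _ "length p - 1 - i"])
      (simp add: interior_rev[simplified] collider_rev[simplified] nth_rev_interior(1)[simplified])
qed

lemma is_path_rev:
  assumes "is_path E u p v"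
  shows "is_path E v (rev p) u"
  using assms unfolding is_path_def
  by (auto simp: hd_rev last_rev disj_commute)

lemma d_separated_sym:
  assumes "d_separated V E X Y Z"
  shows "d_separated V E Y X Z"
  using assms unfolding d_separated_def
  by (metis Int_commute blocked_rev is_path_rev rev_rev_ident)

lemma d_separated_mono:
  assumes "d_separated V E X Y Z" "X' \<subseteq> X" "Y' \<subseteq> Y"
  shows "d_separated V E X' Y' Z"
  using assms unfolding d_separated_def by blast

section \<open>Edges and common children excluded by a separation\<close>

lemma d_separated_imp_nonadjacent:
  assumes "d_separated V E X Y Z" "x \<in> X" "y \<in> Y"
  shows "(x, y) \<notin> E"
proof
  assume "(x, y) \<in> E"
  with assms have "is_path E x [x, y] y"
    by (auto simp: is_path_def d_separated_def)
  with assms have "blocked E Z [x, y]"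
    by (auto simp: d_separated_def)
  then show False
    by (auto simp: blocked_def interior_def)
qed

text \<open>The only interior vertex of the path \<open>x, z, y\<close> would be a collider lying in
  \<open>Z\<close>, which leaves the path open.\<close>

lemma d_separated_imp_no_common_child:
  assumes "d_separated V E X Y Z" "x \<in> X" "y \<in> Y" "z \<in> Z" "(x, z) \<in> E"
  shows "(y, z) \<notin> E"
proof
  assume "(y, z) \<in> E"
  with assms have "is_path E x [x, z, y] y"
    by (auto simp: is_path_def d_separated_def)
  with assms have "blocked E Z [x, z, y]"
    by (auto simp: d_separated_def)
  with assms \<open>(y, z) \<in> E\<close> show False
    by (auto simp: blocked_def interior_def collider_def)
qed

section \<open>Open paths given a set of ancestors\<close>

context dag
begin

lemma unblocked_path_subset_ancestors:
  assumes path: "is_path E u p v" and open_p: "\<not> blocked E S p"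
    and A: "A = {w. (w, u) \<in> E\<^sup>* \<or> (w, v) \<in> E\<^sup>*}" and "S \<subseteq> A"
  shows "set p \<subseteq> A"
proof (rule ccontr)
  assume "\<not> set p \<subseteq> A"
  then obtain w0 where "w0 \<in> set p - A" by blast
  have "finite E"
    using finite_verts edges_subset finite_subset by blast
  then have "wf (E\<inverse>)"
    by (rule finite_acyclic_wf_converse[OF _ acyclic_edges])
  \<comment> \<open>A sink among the path vertices outside \<open>A\<close>. It has no edge into
    \<open>A\<close> either, since \<open>A\<close> is closed under ancestors, so both path edges at
    \<open>w\<close> point into it. As an open collider it would have to be an ancestor of a member
    of \<open>S\<close>, hence in \<open>A\<close>.\<close>
  then obtain w where w: "w \<in> set p - A"
    and sink: "\<And>x. (w, x) \<in> E \<Longrightarrow> x \<notin> set p - A"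
    using \<open>w0 \<in> set p - A\<close> by (rule wfE_min) auto
  have no_out: "(w, x) \<notin> E" if "x \<in> set p" for x
  proof
    assume "(w, x) \<in> E"
    with sink that have "x \<in> A" by blast
    with \<open>(w, x) \<in> E\<close> w show False
      unfolding A by (auto intro: converse_rtrancl_into_rtrancl)
  qed
  obtain i where i: "i < length p" "p ! i = w"
    using w by (auto simp: in_set_conv_nth)
  have "u \<in> A" "v \<in> A" by (auto simp: A)
  with w have "w \<noteq> u" "w \<noteq> v" by auto
  have "i \<noteq> 0"
    using i path \<open>w \<noteq> u\<close> by (metis is_path_def hd_conv_nth)
  moreover have "i \<noteq> length p - 1"
    using i path \<open>w \<noteq> v\<close> by (metis is_path_def last_conv_nth)
  ultimately have int: "interior p i"
    using i by (auto simp: interior_def)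
  have adj: "(p ! j, p ! Suc j) \<in> E \<or> (p ! Suc j, p ! j) \<in> E" if "Suc j < length p" for j
    using path that successively_nth by (fastforce simp: is_path_def)
  have "(p ! (i + 1), p ! i) \<in> E"
    using adj[of i] no_out[of "p ! Suc i"] i int by (auto simp: interior_def)
  moreover have "(p ! (i - 1), p ! i) \<in> E"
    using adj[of "i - 1"] no_out[of "p ! (i - 1)"] i int by (auto simp: interior_def)
  ultimately have "collider E p i"
    using int by (simp add: collider_def)
  with open_p int i have "w \<in> S \<or> descendants E w \<inter> S \<noteq> {}"
    by (auto simp: blocked_def)
  with \<open>S \<subseteq> A\<close> have "w \<in> A"
    unfolding A descendants_def by (auto dest: trancl_into_rtrancl intro: rtrancl_trans)
  with w show False by blast
qed

lemma unblocked_path_starts_at_parent: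
  assumes path: "is_path E u p v" and "\<not> blocked E S p"
    and A: "A = {w. (w, u) \<in> E\<^sup>* \<or> (w, v) \<in> E\<^sup>*}" and "S \<subseteq> A"
    and "(u, v) \<notin> E\<^sup>*" "(v, u) \<notin> E"
  shows "(p ! 1, u) \<in> E" "interior p 1" "p ! 1 \<notin> S"
proof -
  have p0: "p ! 0 = u" and plast: "p ! (length p - 1) = v" and "u \<noteq> v" "p \<noteq> []"
    using path by (auto simp: is_path_def hd_conv_nth last_conv_nth)
  then have len: "1 < length p"
    by (cases p; cases "tl p") auto
  have adj: "(p ! 0, p ! 1) \<in> E \<or> (p ! 1, p ! 0) \<in> E"
    using path len successively_nth[of _ p 0] by (fastforce simp: is_path_def)
  have "p ! 1 \<in> A"
    using unblocked_path_subset_ancestors[OF assms(1-4)] len by auto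
  \<comment> \<open>The second vertex is an ancestor of \<open>u\<close> or of \<open>v\<close>: an
    edge to it from \<open>u\<close> would close a cycle or make \<open>u\<close> an ancestor of
    \<open>v\<close>.\<close>
  have "(u, p ! 1) \<notin> E"
  proof
    assume "(u, p ! 1) \<in> E"
    with \<open>p ! 1 \<in> A\<close> \<open>(u, v) \<notin> E\<^sup>*\<close> have "(p ! 1, u) \<in> E\<^sup>*"
      unfolding A by (auto intro: converse_rtrancl_into_rtrancl)
    with \<open>(u, p ! 1) \<in> E\<close> acyclic_edges show False
      by (meson acyclic_def rtrancl_into_trancl2)
  qed
  with adj p0 show par: "(p ! 1, u) \<in> E" by simp
  have "length p - 1 \<noteq> 1"
    using par plast \<open>(v, u) \<notin> E\<close> by metis
  with len show int: "interior p 1"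
    by (auto simp: interior_def)
  have "\<not> collider E p 1"
    using p0 \<open>(u, p ! 1) \<notin> E\<close> by (auto simp: collider_def)
  with int \<open>\<not> blocked E S p\<close> show "p ! 1 \<notin> S"
    by (auto simp: blocked_def)
qed

text \<open>Parents of \<open>u\<close> are ancestors of \<open>u\<close>, so an open path would
  have to start towards a parent outside the set of all parents.\<close>

lemma d_separated_parents:
  assumes "u \<in> V" "v \<in> V" "u \<noteq> v" "(u, v) \<notin> E\<^sup>*" "(v, u) \<notin> E"
  shows "d_separated V E {u} {v} {w. (w, u) \<in> E}"
proof -
  have "blocked E {w. (w, u) \<in> E} p" if "is_path E u p v" for p
    using unblocked_path_starts_at_parent[OF that _ refl _ assms(4,5), of "{w. (w, u) \<in> E}"]
    by blast
  moreover have "(u, u) \<notin> E"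
    using acyclic_edges by (auto simp: acyclic_def)
  ultimately show ?thesis
    using assms edges_subset by (auto simp: d_separated_def)
qed

lemma d_separated_cut:
  assumes sep: "d_separated V E X Y K" and cover: "V \<subseteq> X \<union> Y \<union> K"
    and "u \<in> V" "v \<in> X" "u \<noteq> v" "(u, v) \<notin> E\<^sup>*" "(v, u) \<notin> E"
    and parents: "{w. (w, u) \<in> E} \<subseteq> Y \<union> K"
  shows "d_separated V E {u} {v} (K \<inter> {w. (w, u) \<in> E\<^sup>* \<or> (w, v) \<in> E\<^sup>*} - {u})"
proof -
  define A where "A = {w. (w, u) \<in> E\<^sup>* \<or> (w, v) \<in> E\<^sup>*}"
  define S where "S = K \<inter> A - {u}"
  have "v \<in> V" "v \<notin> K" "v \<notin> Y"
    using sep \<open>v \<in> X\<close> by (auto simp: d_separated_def)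
  have "blocked E S p" if path: "is_path E u p v" for p
  proof (rule ccontr)
    assume nb: "\<not> blocked E S p"
    have "S \<subseteq> A" by (auto simp: S_def)
    have first: "(p ! 1, u) \<in> E" "interior p 1" "p ! 1 \<notin> S"
      using unblocked_path_starts_at_parent[OF path nb A_def \<open>S \<subseteq> A\<close>] assms by auto
    have "set p \<subseteq> A"
      by (rule unblocked_path_subset_ancestors[OF path nb A_def \<open>S \<subseteq> A\<close>])
    have p0: "p ! 0 = u" and plast: "p ! (length p - 1) = v" and "distinct p"
      using path by (auto simp: is_path_def hd_conv_nth last_conv_nth)
    have adj: "(p ! j, p ! Suc j) \<in> E \<or> (p ! Suc j, p ! j) \<in> E" if "Suc j < length p" for j
      using path that successively_nth by (fastforce simp: is_path_def)
    have in_V: "p ! j \<in> V" if "j < length p" for j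
    proof (cases j)
      case 0
      with p0 \<open>u \<in> V\<close> show ?thesis by simp
    next
      case (Suc k)
      with adj[of k] that edges_subset show ?thesis by auto
    qed
    \<comment> \<open>Past the start, passing from \<open>K\<close> to \<open>S\<close> loses no
      vertex of the path: all its vertices lie in \<open>A\<close>, and \<open>u\<close> does not
      recur. The endpoint \<open>v\<close> is outside \<open>K\<close>.\<close>
    have K_S: "p ! j \<in> S \<and> interior p j" if "0 < j" "j < length p" "p ! j \<in> K" for j
    proof -
      have "p ! j \<noteq> p ! 0"
        using that nth_eq_iff_index_eq[OF \<open>distinct p\<close> that(2), of 0] by (metis less_trans less_irrefl)
      moreover have "p ! j \<in> A"
        using that \<open>set p \<subseteq> A\<close> by auto
      moreover have "j \<noteq> length p - 1"
        using that plast \<open>v \<notin> K\<close> by metis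
      ultimately show ?thesis
        using that p0 by (auto simp: S_def interior_def)
    qed
    have K_collider: "collider E p j" if "0 < j" "j < length p" "p ! j \<in> K" for j
      using K_S[OF that] nb by (auto simp: blocked_def)
    \<comment> \<open>Vertices of \<open>p\<close> in \<open>K\<close> are colliders, hence never consecutive: after its last visit to \<open>Y\<close>
      the path reaches \<open>X\<close> directly or through a common child in \<open>K\<close>.\<close>
    define I where "I = {j. 0 < j \<and> j < length p \<and> p ! j \<in> Y}"
    \<comment> \<open>As a parent of \<open>u\<close>, this vertex lies in \<open>Y\<close> or
      \<open>K\<close>; in \<open>K\<close> it would belong to \<open>S\<close>.\<close>
    have "p ! 1 \<in> Y"
      using first parents K_S[of 1] by (auto simp: interior_def)
    then have "1 \<in> I"
      using first by (auto simp: I_def interior_def)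
    have "finite I" by (auto simp: I_def)
    define i where "i = Max I"
    have "i \<in> I"
      using \<open>finite I\<close> \<open>1 \<in> I\<close> unfolding i_def by (intro Max_in) auto
    then have i: "0 < i" "i < length p" "p ! i \<in> Y"
      by (auto simp: I_def)
    have later: "p ! j \<notin> Y" if "i < j" "j < length p" for j
    proof
      assume "p ! j \<in> Y"
      with that have "j \<in> I" by (auto simp: I_def)
      with \<open>finite I\<close> have "j \<le> i" by (simp add: i_def)
      with \<open>i < j\<close> show False by simp
    qed
    have "i \<noteq> length p - 1"
      using i plast \<open>v \<notin> Y\<close> by metis
    then have si: "Suc i < length p" using i by simp
    have "p ! Suc i \<notin> X"
      using adj[OF si] i d_separated_imp_nonadjacent[OF sep]
        d_separated_imp_nonadjacent[OF d_separated_sym[OF sep]] by blast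
    with later[of "Suc i"] si in_V[OF si] cover have k: "p ! Suc i \<in> K" by auto
    from K_collider[OF _ si k] have into: "(p ! i, p ! Suc i) \<in> E" "(p ! Suc (Suc i), p ! Suc i) \<in> E"
      and ssi: "Suc (Suc i) < length p"
      by (auto simp: collider_def interior_def)
    have "p ! Suc (Suc i) \<notin> K"
    proof
      assume "p ! Suc (Suc i) \<in> K"
      from K_collider[OF _ ssi this] have "(p ! Suc i, p ! Suc (Suc i)) \<in> E"
        by (auto simp: collider_def)
      with into(2) acyclic_edges show False
        by (meson acyclic_def trancl.simps)
    qed
    with later[of "Suc (Suc i)"] ssi in_V[OF ssi] cover have "p ! Suc (Suc i) \<in> X" by auto
    with d_separated_imp_no_common_child[OF sep _ i(3) k into(2)] into(1) show False by blast
  qed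
  then show ?thesis
    using sep assms(3-5) \<open>v \<in> V\<close> \<open>v \<notin> K\<close>
    unfolding d_separated_def S_def A_def by auto
qed

end

section \<open>Separation trees\<close>

lemma in_subtree_nodes_of_shortest_walk:
  assumes walk: "(A, D) \<in> F ^^ n" and shortest: "\<And>m. m < n \<Longrightarrow> (A, D) \<notin> F ^^ m"
    and "n \<noteq> 0"
  obtains B where "(A, B) \<in> F" "(B, D) \<in> F ^^ (n - 1)" "D \<in> subtree_nodes F B A"
proof -
  obtain f where f: "f 0 = A" "f n = D" "\<And>i. i < n \<Longrightarrow> (f i, f (Suc i)) \<in> F"
    using walk by (auto simp: relpow_fun_conv)
  have tail: "(f i, D) \<in> F ^^ (n - i)" if "i \<le> n" for i
    unfolding relpow_fun_conv
    using that f by (intro exI[of _ "\<lambda>k. f (i + k)"]) auto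
  \<comment> \<open>A return to \<open>A\<close> would give a shorter walk to \<open>D\<close>.
    Hence the walk from \<open>f 1\<close> onwards never uses the removed edge.\<close>
  have ne: "f i \<noteq> A" if "0 < i" "i \<le> n" for i
    using that tail[of i] shortest[of "n - i"] by auto
  have "(f 1, f (Suc i)) \<in> (F - {(f 1, A), (A, f 1)})\<^sup>*" if "i < n" for i
    using that
  proof (induction i)
    case 0
    then show ?case by simp
  next
    case (Suc i)
    then have "(f (Suc i), f (Suc (Suc i))) \<in> F - {(f 1, A), (A, f 1)}"
      using f(3)[of "Suc i"] ne[of "Suc i"] ne[of "Suc (Suc i)"] by auto
    with Suc show ?case by (simp add: rtrancl.rtrancl_into_rtrancl)
  qed
  from this[of "n - 1"] have "D \<in> subtree_nodes F (f 1) A"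
    using f \<open>n \<noteq> 0\<close> by (simp add: subtree_nodes_def)
  with that[of "f 1"] f tail[of 1] \<open>n \<noteq> 0\<close> show ?thesis
    by (metis One_nat_def Suc_leI neq0_conv)
qed

text \<open>Along a walk from \<open>A\<close> the side can change only on the removed edge, and
  each end of that edge lies in its own subtree.\<close>

lemma subtree_nodes_cover:
  assumes "(A, D) \<in> F\<^sup>*"
  shows "D \<in> subtree_nodes F A B \<union> subtree_nodes F B A"
  using assms
proof induction
  case base
  then show ?case by (simp add: subtree_nodes_def)
next
  case (step y z)
  have sym: "F - {(B, A), (A, B)} = F - {(A, B), (B, A)}" by auto
  show ?case
  proof (cases "z = A \<or> z = B")
    case True
    then show ?thesis by (auto simp: subtree_nodes_def)
  next
    case False
    with step have "(y, z) \<in> F - {(A, B), (B, A)}" by auto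
    with step.IH show ?thesis
      unfolding subtree_nodes_def sym by (auto intro: rtrancl_into_rtrancl)
  qed
qed

lemma d_separation_tree_edge:
  assumes T: "d_separation_tree V E \<C> F" and AB: "(A, B) \<in> F"
  shows "d_separated V E (\<Union>(subtree_nodes F A B) - A \<inter> B) (\<Union>(subtree_nodes F B A) - A \<inter> B) (A \<inter> B)"
    and "V \<subseteq> \<Union>(subtree_nodes F A B) \<union> \<Union>(subtree_nodes F B A)"
    and "A \<subseteq> \<Union>(subtree_nodes F A B)"
proof -
  show "d_separated V E (\<Union>(subtree_nodes F A B) - A \<inter> B)
      (\<Union>(subtree_nodes F B A) - A \<inter> B) (A \<inter> B)"
    using T AB unfolding d_separation_tree_def Let_def by blast
  have "A \<in> \<C>" and conn: "\<And>D. D \<in> \<C> \<Longrightarrow> (A, D) \<in> F\<^sup>*" and V: "\<Union>\<C> = V"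
    using T AB unfolding d_separation_tree_def is_tree_def by auto
  show "V \<subseteq> \<Union>(subtree_nodes F A B) \<union> \<Union>(subtree_nodes F B A)"
    using subtree_nodes_cover[OF conn] V by blast
  show "A \<subseteq> \<Union>(subtree_nodes F A B)"
    by (auto simp: subtree_nodes_def)
qed

section \<open>Separators obtained from the tree\<close>

lemma d_separated_if_no_common_node:
  assumes T: "d_separation_tree V E \<C> F" and "u \<in> V" "v \<in> V"
    and apart: "\<not> (\<exists>C\<in>\<C>. u \<in> C \<and> v \<in> C)"
  obtains S where "d_separated V E {u} {v} S"
proof -
  have tree: "F \<subseteq> \<C> \<times> \<C>" "\<And>A B. A \<in> \<C> \<Longrightarrow> B \<in> \<C> \<Longrightarrow> (A, B) \<in> F\<^sup>*" "\<Union>\<C> = V"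
    using T unfolding d_separation_tree_def is_tree_def by auto
  obtain D where D: "D \<in> \<C>" "v \<in> D" using tree \<open>v \<in> V\<close> by blast
  \<comment> \<open>\<open>D\<close> is fixed while the starting node varies over all nodes
    containing \<open>u\<close>; minimality of \<open>n\<close> then keeps \<open>u\<close> out of
    the second node \<open>B\<close> of the walk.\<close>
  define P where "P n \<longleftrightarrow> (\<exists>A\<in>\<C>. u \<in> A \<and> (A, D) \<in> F ^^ n)" for n
  obtain A0 where "A0 \<in> \<C>" "u \<in> A0" using tree \<open>u \<in> V\<close> by blast
  then have "\<exists>n. P n"
    unfolding P_def using tree(2)[of A0 D] D by (meson rtrancl_imp_relpow)
  then obtain n where n: "P n" "\<And>m. m < n \<Longrightarrow> \<not> P m"
    using exists_least_iff[of P] by blast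
  then obtain A where A: "A \<in> \<C>" "u \<in> A" "(A, D) \<in> F ^^ n"
    unfolding P_def by blast
  have "n \<noteq> 0" using A D apart by (metis relpow_0_E)
  have "(A, D) \<notin> F ^^ m" if "m < n" for m
    using n(2)[OF that] A by (auto simp: P_def)
  then obtain B where B: "(A, B) \<in> F" "(B, D) \<in> F ^^ (n - 1)" "D \<in> subtree_nodes F B A"
    using in_subtree_nodes_of_shortest_walk A(3) \<open>n \<noteq> 0\<close> by metis
  have "u \<notin> B"
    using n(2)[of "n - 1"] B tree(1) \<open>n \<noteq> 0\<close> by (auto simp: P_def)
  moreover have "v \<notin> A" using A apart by blast
  ultimately have "d_separated V E {u} {v} (A \<inter> B)"
    using d_separation_tree_edge(3)[OF T B(1)] A B(3) D
    by (intro d_separated_mono[OF d_separation_tree_edge(1)[OF T B(1)]]) auto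
  then show thesis by (rule that)
qed

text \<open>The edge from \<open>p\<close> in \<open>Y\<close> forces \<open>u\<close> into
  \<open>K\<close>, as no edge joins \<open>X\<close> and \<open>Y\<close>. A parent in
  \<open>X\<close> would then share the child \<open>u\<close> in \<open>K\<close> with
  \<open>p\<close>.\<close>

lemma (in dag) parents_on_one_side:
  assumes sep: "d_separated V E X Y K" and cover: "V \<subseteq> X \<union> Y \<union> K"
    and "u \<in> X \<union> K" "(p, u) \<in> E" "p \<in> Y" "(q, u) \<in> E"
  shows "q \<in> Y \<union> K"
proof -
  have "u \<in> K"
    using assms d_separated_imp_nonadjacent[OF d_separated_sym[OF sep]] by blast
  then have "q \<notin> X"
    using assms d_separated_imp_no_common_child[OF sep] by blast
  with cover edges_subset assms show ?thesis by auto
qed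

lemma (in dag) d_separated_within_node:
  assumes T: "d_separation_tree V E \<C> F" and "u \<noteq> v"
    and "(u, v) \<notin> E\<^sup>*" "(v, u) \<notin> E" and common: "C0 \<in> \<C>" "u \<in> C0" "v \<in> C0"
  obtains C S where "C \<in> \<C>" "u \<in> C" "v \<in> C" "S \<subseteq> C" "d_separated V E {u} {v} S"
proof -
  define Q where "Q C \<longleftrightarrow> C \<in> \<C> \<and> u \<in> C \<and> v \<in> C" for C
  define pa where "pa = {w. (w, u) \<in> E}"
  have tree: "F \<subseteq> \<C> \<times> \<C>" "\<And>A B. A \<in> \<C> \<Longrightarrow> B \<in> \<C> \<Longrightarrow> (A, B) \<in> F\<^sup>*" "\<Union>\<C> = V"
    using T unfolding d_separation_tree_def is_tree_def by auto
  have "u \<in> V" "v \<in> V" using tree(3) common by auto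
  have "pa \<subseteq> V" using edges_subset by (auto simp: pa_def)
  then have "finite pa" using finite_verts by (rule finite_subset)
  have "Q C0" using common by (simp add: Q_def)
  moreover have "\<forall>C. Q C \<longrightarrow> card (C \<inter> pa) < Suc (card pa)"
    using \<open>finite pa\<close> by (auto intro!: card_mono simp: less_Suc_eq_le)
  ultimately obtain M where M: "Q M" "\<And>C. Q C \<Longrightarrow> card (C \<inter> pa) \<le> card (M \<inter> pa)"
    using ex_has_greatest_nat[of Q C0 "\<lambda>C. card (C \<inter> pa)" "Suc (card pa)"] by auto
  show thesis
  proof (cases "pa \<subseteq> M")
    case True
    with M(1) d_separated_parents[OF \<open>u \<in> V\<close> \<open>v \<in> V\<close> assms(2-4)] that[of M pa] show thesis
      by (simp add: Q_def pa_def)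
  next
    case False
    then obtain p where p: "p \<in> pa" "p \<notin> M" by blast
    obtain D where D: "D \<in> \<C>" "p \<in> D" using p \<open>pa \<subseteq> V\<close> tree(3) by blast
    \<comment> \<open>The distance to \<open>D\<close> is minimised only among nodes with exactly
      the parents of \<open>M\<close>, so that \<open>p\<close> stays missing and the maximal count
      is kept.\<close>
    define P where "P n \<longleftrightarrow> (\<exists>C. Q C \<and> C \<inter> pa = M \<inter> pa \<and> (C, D) \<in> F ^^ n)" for n
    have "(M, D) \<in> F\<^sup>*"
      using tree(2) D M(1) by (simp add: Q_def)
    then obtain k where "(M, D) \<in> F ^^ k"
      using rtrancl_imp_relpow by blast
    with M(1) have "P k" by (auto simp: P_def)
    then have "\<exists>n. P n" by blast
    then obtain n where n: "P n" "\<And>m. m < n \<Longrightarrow> \<not> P m"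
      using exists_least_iff[of P] by blast
    then obtain C where C: "Q C" "C \<inter> pa = M \<inter> pa" "(C, D) \<in> F ^^ n"
      unfolding P_def by blast
    have "p \<notin> C" using C(2) p by blast
    then have "n \<noteq> 0" using C D by (metis relpow_0_E)
    have "(C, D) \<notin> F ^^ m" if "m < n" for m
      using n(2)[OF that] C by (auto simp: P_def)
    then obtain B where B: "(C, B) \<in> F" "(B, D) \<in> F ^^ (n - 1)" "D \<in> subtree_nodes F B C"
      using in_subtree_nodes_of_shortest_walk C(3) \<open>n \<noteq> 0\<close> by metis
    define K where "K = C \<inter> B"
    define X where "X = \<Union>(subtree_nodes F C B) - K"
    define Y where "Y = \<Union>(subtree_nodes F B C) - K"
    have sep: "d_separated V E X Y K" and cover: "V \<subseteq> X \<union> Y \<union> K"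
      and CX: "C \<subseteq> X \<union> K"
      using d_separation_tree_edge[OF T B(1)] by (auto simp: X_def Y_def K_def)
    have "p \<in> Y"
      using D B \<open>p \<notin> C\<close> by (auto simp: Y_def K_def)
    have "u \<in> X \<union> K" "u \<in> C" "v \<in> C" using C(1) CX by (auto simp: Q_def)
    have par: "pa \<subseteq> Y \<union> K"
      using parents_on_one_side[OF sep cover \<open>u \<in> X \<union> K\<close> _ \<open>p \<in> Y\<close>] p(1)
      by (auto simp: pa_def)
    have "u \<in> K"
      using \<open>u \<in> X \<union> K\<close> p(1) \<open>p \<in> Y\<close> d_separated_imp_nonadjacent[OF d_separated_sym[OF sep]]
      by (auto simp: pa_def)
    \<comment> \<open>Otherwise \<open>B\<close> contains \<open>u\<close> and \<open>v\<close>. The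
      parents in \<open>C\<close> all lie in \<open>K\<close>, hence in \<open>B\<close>; by
      maximality \<open>B\<close> has no others, yet it is one step closer to
      \<open>D\<close>.\<close>
    have "v \<notin> K"
    proof
      assume "v \<in> K"
      with \<open>u \<in> K\<close> B(1) tree(1) have "Q B" by (auto simp: Q_def K_def)
      have "X \<inter> Y = {}" using sep by (simp add: d_separated_def)
      with par CX have sub: "C \<inter> pa \<subseteq> B \<inter> pa" by (auto simp: K_def)
      have "C \<inter> pa = B \<inter> pa"
        using card_seteq[OF _ sub] M(2)[OF \<open>Q B\<close>] \<open>finite pa\<close> C(2) by simp
      with \<open>Q B\<close> B(2) C(2) have "P (n - 1)" by (auto simp: P_def)
      with n(2)[of "n - 1"] \<open>n \<noteq> 0\<close> show False by simp
    qed
    with \<open>v \<in> C\<close> CX have "v \<in> X" by blast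
    have "d_separated V E {u} {v} (K \<inter> {w. (w, u) \<in> E\<^sup>* \<or> (w, v) \<in> E\<^sup>*} - {u})"
      using d_separated_cut[OF sep cover \<open>u \<in> V\<close> \<open>v \<in> X\<close> assms(2-4)] par by (simp add: pa_def)
    with C(1) show thesis
      by (intro that[of C]) (auto simp: Q_def K_def)
  qed
qed

section \<open>The equivalence\<close>

theorem theorem2p1:
  fixes V :: "'a set" and E :: "('a \<times> 'a) set"
    and \<C> :: "'a set set" and F :: "('a set \<times> 'a set) set"
    and u v :: 'a
  assumes "dag V E"
    and "d_separation_tree V E \<C> F"
    and "u \<in> V" and "v \<in> V" and "u \<noteq> v"
  shows "(\<exists>S. S \<subseteq> V - {u, v} \<and> d_separated V E {u} {v} S) \<longleftrightarrow>
    (\<not> (\<exists>C\<in>\<C>. u \<in> C \<and> v \<in> C)) \<or>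
    (\<exists>C\<in>\<C>. u \<in> C \<and> v \<in> C \<and>
      (\<exists>S. S \<subseteq> C \<and> u \<notin> S \<and> v \<notin> S \<and> d_separated V E {u} {v} S))"
    (is "?L \<longleftrightarrow> ?N \<or> ?R")
proof -
  interpret dag V E by fact
  have avoid: "S \<subseteq> V - {u, v}" if "d_separated V E {u} {v} S" for S
    using that by (auto simp: d_separated_def)
  have "?R" if "?L" "\<not> ?N"
  proof -
    from \<open>?L\<close> obtain S0 where S0: "d_separated V E {u} {v} S0" by blast
    have nonadj: "(u, v) \<notin> E" "(v, u) \<notin> E"
      using d_separated_imp_nonadjacent[OF S0] d_separated_imp_nonadjacent[OF d_separated_sym[OF S0]]
      by auto
    from \<open>\<not> ?N\<close> obtain C0 where C0: "C0 \<in> \<C>" "u \<in> C0" "v \<in> C0" by blast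
    \<comment> \<open>Whichever vertex is not an ancestor of the other takes the role of
      \<open>u\<close> in \<open>d_separated_within_node\<close>.\<close>
    have "(u, v) \<notin> E\<^sup>* \<or> (v, u) \<notin> E\<^sup>*"
      using acyclic_edges \<open>u \<noteq> v\<close>
      by (metis acyclic_def rtranclD rtrancl_trancl_trancl)
    then obtain C S where "C \<in> \<C>" "u \<in> C" "v \<in> C" "S \<subseteq> C" "d_separated V E {u} {v} S"
    proof
      assume "(u, v) \<notin> E\<^sup>*"
      then show thesis
        using d_separated_within_node[OF assms(2,5) _ nonadj(2) C0] that by blast
    next
      assume "(v, u) \<notin> E\<^sup>*"
      then show thesis
        using d_separated_within_node[OF assms(2) assms(5)[symmetric] _ nonadj(1) C0(1,3,2)] that
          d_separated_sym by metis
    qed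
    then show ?R using avoid by blast
  qed
  moreover have "?L" if "?N"
    using d_separated_if_no_common_node[OF assms(2-4) that] avoid by metis
  moreover have "?R \<Longrightarrow> ?L"
    using avoid by blast
  ultimately show ?thesis by blast
qed

end
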